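(* Let $V$ be a nondoubled word and let $q\in\mathbb{Z}^+$. Then the limit $\mathbb{I}(V,q)=\lim_{n\to\infty}\mathbb{I}_n(V,q)$ exists. Moreover, $\mathbb{I}(V,q)\geq q^{-\|V\|}>0$.
   Context: A word is doubled if every letter occurring in it occurs at least twice; it is nondoubled if some letter occurs in it exactly once. For a word $V$, $|V|$ is its length, $\mathrm{L}(V)$ is the set of letters occurring in $V$, and $\|V\|=|V|-|\mathrm{L}(V)|$ is the number of letter recurrences. A word $U$ is an instance of $V$ (a $V$-instance) if $U=\phi(V)$ for some homomorphism $\phi$ of free monoids that is nonerasing (no letter is mapped to the empty word). $[q]=\{1,\dots,q\}$, and $\mathbb{I}_n(V,q)$ is the probability that a uniformly random word in $[q]^n$ is a $V$-instance. *)

theory Defs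
  imports "HOL-Probability.Probability"
begin

definition nondoubled :: "'a list \<Rightarrow> bool" where
  "nondoubled V \<longleftrightarrow> (\<exists>x \<in> set V. count_list V x = 1)"

(* The subtraction on nat does not truncate: card (set V) \<le> length V. *)
definition recurrences :: "'a list \<Rightarrow> nat" where
  "recurrences V = length V - card (set V)"

definition free_monoid_hom :: "('a list \<Rightarrow> 'b list) \<Rightarrow> bool" where
  "free_monoid_hom \<phi> \<longleftrightarrow> \<phi> [] = [] \<and> (\<forall>u v. \<phi> (u @ v) = \<phi> u @ \<phi> v)"

definition nonerasing :: "('a list \<Rightarrow> 'b list) \<Rightarrow> bool" where
  "nonerasing \<phi> \<longleftrightarrow> (\<forall>x. \<phi> [x] \<noteq> [])"

(* The alphabets are the whole types 'a and 'b. Nothing depends on this choice: letters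
   not in V do not affect \<phi> V, and the image of a letter in V is a factor of U, hence
   uses only letters of U. *)
definition instance_of :: "'a list \<Rightarrow> 'b list \<Rightarrow> bool" where
  "instance_of V U \<longleftrightarrow> (\<exists>\<phi>. free_monoid_hom \<phi> \<and> nonerasing \<phi> \<and> U = \<phi> V)"

definition words :: "nat \<Rightarrow> nat \<Rightarrow> nat list set" where
  "words q n = {W. length W = n \<and> set W \<subseteq> {1..q}}"

(* pmf_of_set is meaningful only for finite nonempty sets; words q n is one when q > 0. *)
definition instance_prob :: "nat \<Rightarrow> 'a list \<Rightarrow> nat \<Rightarrow> real" where
  "instance_prob n V q = measure_pmf.prob (pmf_of_set (words q n)) {U. instance_of V U}"

definition asymptotic_instance_prob :: "'a list \<Rightarrow> nat \<Rightarrow> real" where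
  "asymptotic_instance_prob V q = lim (\<lambda>n. instance_prob n V q)"

end

theory Submission
  imports Defs "HOL-Library.Sublist"
begin

text \<open>
  Write \<^term>\<open>V = P @ x # S\<close> with \<^term>\<open>x\<close> a letter that occurs once. Since the image of
  \<^term>\<open>x\<close> may be any nonempty word, a word \<^term>\<open>W\<close> is a \<^term>\<open>V\<close>-instance iff some nonerasing
  \<^term>\<open>h\<close> makes the image of \<^term>\<open>P\<close> a prefix of \<^term>\<open>W\<close>, the image of \<^term>\<open>S\<close> a suffix
  of \<^term>\<open>W\<close>, with a nonempty gap between them. If the total length of these two images is required to
  be at most \<^term>\<open>M\<close>, the event depends only on the first and the last \<^term>\<open>M\<close> letters of
  \<^term>\<open>W\<close>, and its probability is the same for all lengths above \<^term>\<open>2 * M\<close>. So the limit exists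
  as soon as long images contribute little, uniformly in the length of \<^term>\<open>W\<close>: this is the
  property \<open>tight_pair\<close>, and \<open>tight_imp_convergent\<close> makes the Cauchy argument.

  Tightness holds for every pair \<^term>\<open>(P, S)\<close> over an alphabet of at least two letters
  (\<open>tight_pair_all\<close>), by induction on the total length.

  \<^item> If every letter of \<^term>\<open>P @ S\<close> occurs at least twice in it, a fixed \<^term>\<open>h\<close> succeeds with
    probability at most the product of \<open>q\<close> to the power \<open>-2|h y|\<close> over the letters \<open>y\<close>. As there
    are only \<open>q\<close> to the power \<open>l\<close> words of length \<open>l\<close>, these products have a finite sum over all
    \<^term>\<open>h\<close>; the union bound over all but finitely many \<^term>\<open>h\<close> is therefore small
    (\<open>tight_of_doubled\<close>).

  \<^item> Otherwise some letter \<^term>\<open>z\<close> occurs exactly once, say \<^term>\<open>P = P' @ z # Q\<close>. The factor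
    \<^term>\<open>Q\<close> is not anchored at either end of the word: given a short match of \<^term>\<open>(P', S)\<close>, it
    suffices that the (short) image of \<^term>\<open>Q\<close> occurs somewhere in a window beyond the image of
    \<^term>\<open>P'\<close>, for \<^term>\<open>z\<close> can absorb whatever lies in front of it. A long enough window
    contains all short words with probability close to 1. So tightness passes from
    \<^term>\<open>(P', S)\<close> to \<^term>\<open>(P, S)\<close> (\<open>tight_insert_floating\<close>); the case that \<^term>\<open>z\<close> occurs in
    \<^term>\<open>S\<close> follows by reversing all words.

  The lower bound holds for each length \<open>n \<ge> |V|\<close> separately, by counting the instances in which every
  letter except \<^term>\<open>x\<close> is replaced by a single letter (\<open>instance_prob_ge\<close>). For \<open>q = 1\<close> this bound
  is 1, which also settles convergence in that case.
\<close>

section \<open>Uniformly random words\<close>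

abbreviation word_prob :: "nat \<Rightarrow> nat \<Rightarrow> nat list set \<Rightarrow> real" where
  "word_prob q n A \<equiv> measure_pmf.prob (pmf_of_set (words q n)) A"

lemma finite_words: "finite (words q n)"
  and card_words: "card (words q n) = q ^ n"
proof -
  have eq: "words q n = {xs. set xs \<subseteq> {1..q} \<and> length xs = n}" by (auto simp: words_def)
  show "finite (words q n)" unfolding eq by (rule finite_lists_length_eq) simp
  show "card (words q n) = q ^ n" unfolding eq by (subst card_lists_length_eq) auto
qed

lemma words_nonempty: "q > 0 \<Longrightarrow> words q n \<noteq> {}"
  using card_words[of q n] by (metis card.empty power_not_zero neq0_conv)

lemma word_prob_eq_card: "q > 0 \<Longrightarrow> word_prob q n A = real (card (words q n \<inter> A)) / real q ^ n"
  by (simp add: measure_pmf_of_set finite_words words_nonempty card_words)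

lemma word_prob_mono:
  assumes "q > 0" and "\<And>W. W \<in> words q n \<Longrightarrow> W \<in> A \<Longrightarrow> W \<in> B"
  shows "word_prob q n A \<le> word_prob q n B"
  unfolding word_prob_eq_card[OF assms(1)]
  by (intro divide_right_mono of_nat_mono card_mono) (use assms finite_words in auto)

text \<open>All probabilities below are computed from this one fact: once both ends are prescribed, the
  \<^term>\<open>k\<close> letters in the middle are free, so they do not influence the probability.\<close>

lemma word_prob_sandwich:
  assumes "q > 0" and "A \<subseteq> words q i \<times> words q j"
  shows "word_prob q (i + k + j) {u @ m @ v |u m v. (u, v) \<in> A \<and> length m = k}
           = real (card A) / real q ^ (i + j)"
proof -
  let ?f = "\<lambda>((u, v), m). u @ m @ v"
  have eq: "words q (i + k + j) \<inter> {u @ m @ v |u m v. (u, v) \<in> A \<and> length m = k}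
              = ?f ` (A \<times> words q k)" (is "?L = ?R")
  proof
    show "?L \<subseteq> ?R"
    proof
      fix W assume "W \<in> ?L"
      then obtain u m v where W: "W = u @ m @ v" "(u, v) \<in> A" "length m = k" "W \<in> words q (i + k + j)"
        by blast
      then have "m \<in> words q k" by (auto simp: words_def)
      with W show "W \<in> ?R" by (intro image_eqI[of _ _ "((u, v), m)"]) auto
    qed
    show "?R \<subseteq> ?L"
    proof (rule image_subsetI, clarify)
      fix u v m assume *: "(u, v) \<in> A" "m \<in> words q k"
      then have "u \<in> words q i" "v \<in> words q j" using assms(2) by auto
      with * show "u @ m @ v \<in> ?L" by (auto simp: words_def)
    qed
  qed
  have inj: "inj_on ?f (A \<times> words q k)"
  proof (rule inj_onI, clarify)
    fix u v m u' v' m'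
    assume "(u, v) \<in> A" "(u', v') \<in> A" "m \<in> words q k" "m' \<in> words q k" "u @ m @ v = u' @ m' @ v'"
    moreover from this assms(2) have "length u = length u'" "length m = length m'"
      by (auto simp: words_def)
    ultimately show "(u, v) = (u', v') \<and> m = m'" by simp
  qed
  have "card (words q (i + k + j) \<inter> {u @ m @ v |u m v. (u, v) \<in> A \<and> length m = k}) = card A * q ^ k"
    unfolding eq card_image[OF inj] by (simp add: card_cartesian_product card_words)
  then show ?thesis using assms(1) by (simp add: word_prob_eq_card power_add field_simps)
qed

lemma word_prob_rev:
  assumes "q > 0"
  shows "word_prob q n {W. Q (rev W)} = word_prob q n {W. Q W}"
proof -
  have "words q n \<inter> {W. Q (rev W)} = rev ` (words q n \<inter> {W. Q W})"
    by (auto simp: words_def intro!: image_eqI[of W rev "rev W" for W])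
  then show ?thesis using assms by (simp add: word_prob_eq_card card_image)
qed

section \<open>Instances as matches of a prefix and a suffix\<close>

text \<open>The word \<^term>\<open>m\<close> stands for the image of the omitted nonrecurring letter. The bound
  \<^term>\<open>M\<close> is only on the two outer images; \<^term>\<open>M = length W\<close> amounts to no bound.\<close>

definition matches :: "'a list \<Rightarrow> 'a list \<Rightarrow> nat \<Rightarrow> nat list \<Rightarrow> bool" where
  "matches P S M W \<longleftrightarrow> (\<exists>h m. (\<forall>x. h x \<noteq> []) \<and> m \<noteq> [] \<and>
     W = concat (map h P) @ m @ concat (map h S) \<and>
     length (concat (map h P)) + length (concat (map h S)) \<le> M)"

lemma hom_eq_concat_map: "free_monoid_hom \<phi> \<Longrightarrow> \<phi> V = concat (map (\<lambda>x. \<phi> [x]) V)"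
proof (induction V)
  case (Cons x V)
  then show ?case using Cons unfolding free_monoid_hom_def
    by (metis append_Cons append_Nil concat.simps(2) list.simps(9))
qed (simp add: free_monoid_hom_def)

lemma instance_of_iff:
  "instance_of V U \<longleftrightarrow> (\<exists>h. (\<forall>x. h x \<noteq> []) \<and> U = concat (map h V))"
proof
  assume "instance_of V U"
  then obtain \<phi> where \<phi>: "free_monoid_hom \<phi>" "nonerasing \<phi>" "U = \<phi> V"
    unfolding instance_of_def by blast
  then show "\<exists>h. (\<forall>x. h x \<noteq> []) \<and> U = concat (map h V)"
    using hom_eq_concat_map[OF \<phi>(1), of V]
    by (intro exI[of _ "\<lambda>x. \<phi> [x]"]) (simp add: nonerasing_def)
next
  assume "\<exists>h. (\<forall>x. h x \<noteq> []) \<and> U = concat (map h V)"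
  then obtain h where "\<forall>x. h x \<noteq> []" "U = concat (map h V)" by blast
  then show "instance_of V U"
    unfolding instance_of_def free_monoid_hom_def nonerasing_def
    by (intro exI[of _ "\<lambda>V. concat (map h V)"]) simp
qed

lemma instance_of_iff_matches:
  assumes "x \<notin> set P" "x \<notin> set S"
  shows "instance_of (P @ x # S) W \<longleftrightarrow> matches P S (length W) W"
proof
  assume "instance_of (P @ x # S) W"
  then obtain h where "\<forall>y. h y \<noteq> []" "W = concat (map h P) @ h x @ concat (map h S)"
    by (auto simp: instance_of_iff)
  then show "matches P S (length W) W" unfolding matches_def by (intro exI[of _ h] exI[of _ "h x"]) auto
next
  assume "matches P S (length W) W"
  then obtain h m where h: "\<forall>y. h y \<noteq> []" "m \<noteq> []"
    "W = concat (map h P) @ m @ concat (map h S)" unfolding matches_def by blast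
  have "map (h(x := m)) P = map h P" "map (h(x := m)) S = map h S" using assms by auto
  then show "instance_of (P @ x # S) W"
    unfolding instance_of_iff using h by (intro exI[of _ "h(x := m)"]) (simp del: map_eq_conv)
qed

lemma matches_mono: "matches P S M W \<Longrightarrow> M \<le> N \<Longrightarrow> matches P S N W"
  unfolding matches_def using le_trans by blast

lemma matches_rev_imp: "matches P S M W \<Longrightarrow> matches (rev S) (rev P) M (rev W)"
proof -
  assume "matches P S M W"
  then obtain h m where h: "\<forall>y. h y \<noteq> []" "m \<noteq> []" "W = concat (map h P) @ m @ concat (map h S)"
    "length (concat (map h P)) + length (concat (map h S)) \<le> M" unfolding matches_def by blast
  have r: "concat (map (rev \<circ> h) (rev U)) = rev (concat (map h U))" for U
    by (simp add: rev_concat rev_map)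
  show ?thesis unfolding matches_def
    by (rule exI[of _ "rev \<circ> h"], rule exI[of _ "rev m"]) (unfold r, use h in auto)
qed

lemma matches_rev: "matches (rev S) (rev P) M (rev W) \<longleftrightarrow> matches P S M W"
  using matches_rev_imp[of P S M W] matches_rev_imp[of "rev S" "rev P" M "rev W"] by auto

section \<open>Tightness and convergence\<close>

text \<open>Tightness in the sense of probability measures: up to \<^term>\<open>\<epsilon>\<close>, and uniformly in the length of
  the word, matches of bounded length are the only ones that count.\<close>

definition tight_pair :: "nat \<Rightarrow> 'a list \<Rightarrow> 'a list \<Rightarrow> bool" where
  "tight_pair q P S \<longleftrightarrow> (\<forall>\<epsilon>>0. \<exists>M. \<forall>n. word_prob q n {W. matches P S n W \<and> \<not> matches P S M W} \<le> \<epsilon>)"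

lemma tight_rev:
  assumes "q > 0" and "tight_pair q (rev S) (rev P)"
  shows "tight_pair q P S"
proof -
  have "word_prob q n {W. matches P S n W \<and> \<not> matches P S M W} =
      word_prob q n {W. matches (rev S) (rev P) n W \<and> \<not> matches (rev S) (rev P) M W}" for n M
    using word_prob_rev[OF assms(1), of n "\<lambda>W. matches (rev S) (rev P) n W \<and> \<not> matches (rev S) (rev P) M W"]
    by (simp add: matches_rev)
  then show ?thesis using assms(2) by (simp add: tight_pair_def)
qed

lemma matches_sandwich:
  assumes "length u = M" "length v = M" "m \<noteq> []"
  shows "matches P S M (u @ m @ v) \<longleftrightarrow>
    (\<exists>h. (\<forall>x. h x \<noteq> []) \<and> prefix (concat (map h P)) u \<and> suffix (concat (map h S)) v \<and>
     length (concat (map h P)) + length (concat (map h S)) \<le> M)" (is "_ \<longleftrightarrow> ?R")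
proof
  assume "matches P S M (u @ m @ v)"
  then obtain h m' where h: "\<forall>y. h y \<noteq> []" "u @ m @ v = concat (map h P) @ m' @ concat (map h S)"
    "length (concat (map h P)) + length (concat (map h S)) \<le> M" unfolding matches_def by blast
  have "prefix (concat (map h P)) (u @ m @ v)" unfolding h(2) by simp
  then have "prefix (concat (map h P)) u"
    by (rule prefix_length_prefix) (use h(3) assms in auto)
  moreover have "suffix (concat (map h S)) (u @ m @ v)" unfolding h(2) by (simp add: suffix_def)
  then have "suffix (concat (map h S)) v"
    by (rule suffix_length_suffix) (use h(3) assms in \<open>auto simp: suffix_def\<close>)
  ultimately show ?R using h by blast
next
  assume ?R
  then obtain h u' v' where h: "\<forall>x. h x \<noteq> []" "u = concat (map h P) @ u'" "v = v' @ concat (map h S)"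
    "length (concat (map h P)) + length (concat (map h S)) \<le> M" by (auto simp: prefix_def suffix_def)
  then show "matches P S M (u @ m @ v)"
    unfolding matches_def using assms(3) by (intro exI[of _ h] exI[of _ "u' @ m @ v'"]) auto
qed

text \<open>By \<open>matches_sandwich\<close>, a match of total length at most \<^term>\<open>M\<close> sees only the two ends of
  length \<^term>\<open>M\<close>; these are disjoint, with a letter to spare for the gap, once
  \<^term>\<open>n > 2 * M\<close>.\<close>

lemma word_prob_matches_stationary:
  assumes "q > 0"
  shows "\<exists>c. \<forall>n>2 * M. word_prob q n {W. matches P S M W} = c"
proof -
  define A where "A = {(u, v). u \<in> words q M \<and> v \<in> words q M \<and>
    (\<exists>h. (\<forall>x. h x \<noteq> []) \<and> prefix (concat (map h P)) u \<and> suffix (concat (map h S)) v \<and>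
     length (concat (map h P)) + length (concat (map h S)) \<le> M)}"
  have A: "A \<subseteq> words q M \<times> words q M" by (auto simp: A_def)
  have "word_prob q n {W. matches P S M W} = real (card A) / real q ^ (M + M)" if "n > 2 * M" for n
  proof -
    define k where "k = n - 2 * M"
    have n: "n = M + k + M" "k > 0" using that by (auto simp: k_def)
    have "words q n \<inter> {W. matches P S M W}
        = words q n \<inter> {u @ m @ v |u m v. (u, v) \<in> A \<and> length m = k}" (is "?L = ?R")
    proof (intro set_eqI iffI)
      fix W assume W: "W \<in> ?L"
      define u m v where "u = take M W" "m = take k (drop M W)" "v = drop k (drop M W)"
      have Weq: "W = u @ m @ v" unfolding u_m_v_def by (metis append_take_drop_id)
      have l: "length u = M" "length m = k" "length v = M"
        using W n by (auto simp: u_m_v_def words_def)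
      have "u \<in> words q M" "v \<in> words q M" using W l by (auto simp: words_def Weq)
      then have "(u, v) \<in> A"
        using matches_sandwich[OF l(1,3), of m P S] W n l by (auto simp: A_def Weq)
      then show "W \<in> ?R" using W Weq l by blast
    next
      fix W assume W: "W \<in> ?R"
      then obtain u m v where Weq: "W = u @ m @ v" "(u, v) \<in> A" "length m = k" by blast
      then show "W \<in> ?L"
        using matches_sandwich[of u M v m P S] W n by (auto simp: A_def words_def)
    qed
    then show ?thesis using word_prob_sandwich[OF assms A, of k] assms
      by (simp add: word_prob_eq_card n)
  qed
  then show ?thesis by blast
qed

text \<open>For a suitable \<^term>\<open>M\<close> the probability is arbitrarily close, for all \<^term>\<open>n\<close> beyond
  \<^term>\<open>2 * M\<close>, to that of a match of length at most \<^term>\<open>M\<close>, which is constant there. Hence the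
  sequence is Cauchy.\<close>

lemma tight_imp_convergent:
  assumes "q > 0" and "tight_pair q P S"
  shows "convergent (\<lambda>n. word_prob q n {W. matches P S n W})"
proof -
  have "Cauchy (\<lambda>n. word_prob q n {W. matches P S n W})"
  proof (rule metric_CauchyI)
    fix e :: real assume "e > 0"
    then obtain M where M: "\<And>n. word_prob q n {W. matches P S n W \<and> \<not> matches P S M W} \<le> e / 3"
      using assms(2) unfolding tight_pair_def by (metis divide_pos_pos zero_less_numeral)
    obtain c where c: "\<And>n. n > 2 * M \<Longrightarrow> word_prob q n {W. matches P S M W} = c"
      using word_prob_matches_stationary[OF assms(1)] by blast
    have close: "\<bar>word_prob q n {W. matches P S n W} - c\<bar> \<le> e / 3" if "n > 2 * M" for n
    proof -
      have "{W. matches P S n W} = {W. matches P S M W} \<union> {W. matches P S n W \<and> \<not> matches P S M W}"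
        using matches_mono[of P S M _ n] that by auto
      then have "word_prob q n {W. matches P S n W}
          = word_prob q n {W. matches P S M W} + word_prob q n {W. matches P S n W \<and> \<not> matches P S M W}"
        by (subst measure_pmf.finite_measure_Union[symmetric]) auto
      then show ?thesis using M[of n] c[OF that] measure_nonneg[of "pmf_of_set (words q n)"] by auto
    qed
    show "\<exists>N. \<forall>m\<ge>N. \<forall>n\<ge>N. dist (word_prob q m {W. matches P S m W}) (word_prob q n {W. matches P S n W}) < e"
    proof (intro exI[of _ "2 * M + 1"] allI impI)
      fix m n assume "2 * M + 1 \<le> m" "2 * M + 1 \<le> n"
      then show "dist (word_prob q m {W. matches P S m W}) (word_prob q n {W. matches P S n W}) < e"
        using close[of m] close[of n] \<open>e > 0\<close> unfolding dist_real_def by linarith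
    qed
  qed
  then show ?thesis by (rule Cauchy_convergent)
qed

section \<open>Long windows contain all short words\<close>

text \<open>A word avoiding \<^term>\<open>Z\<close> avoids it in particular in each of the \<^term>\<open>r\<close> consecutive
  aligned blocks of length \<^term>\<open>k\<close>.\<close>

lemma card_avoiding_blocks:
  assumes "q > 0" "Z \<in> words q k"
  shows "card {W \<in> words q (k * r). \<not> sublist Z W} \<le> (q ^ k - 1) ^ r"
proof (induction r)
  case 0
  have "{W \<in> words q 0. \<not> sublist Z W} \<subseteq> {[]}" by (auto simp: words_def)
  from card_mono[OF _ this] show ?case by simp
next
  case (Suc r)
  let ?A = "{W \<in> words q (k * r). \<not> sublist Z W}"
  have "{W \<in> words q (k * Suc r). \<not> sublist Z W} \<subseteq> (\<lambda>(u, w). u @ w) ` ((words q k - {Z}) \<times> ?A)"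
  proof
    fix W assume W: "W \<in> {W \<in> words q (k * Suc r). \<not> sublist Z W}"
    have "take k W \<in> words q k" "drop k W \<in> words q (k * r)"
      using W by (auto simp: words_def dest: in_set_takeD in_set_dropD)
    moreover have "\<not> sublist Z (drop k W)" "take k W \<noteq> Z"
      using W sublist_append[of Z "take k W" "drop k W"] by auto
    ultimately show "W \<in> (\<lambda>(u, w). u @ w) ` ((words q k - {Z}) \<times> ?A)"
      by (intro image_eqI[of _ _ "(take k W, drop k W)"]) auto
  qed
  then have "card {W \<in> words q (k * Suc r). \<not> sublist Z W}
      \<le> card ((\<lambda>(u, w). u @ w) ` ((words q k - {Z}) \<times> ?A))"
    by (intro card_mono) (auto simp: finite_words)
  also have "\<dots> \<le> card ((words q k - {Z}) \<times> ?A)"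
    by (intro card_image_le) (auto simp: finite_words)
  also have "\<dots> = (q ^ k - 1) * card ?A"
    using assms by (simp add: card_cartesian_product card_words finite_words)
  also have "\<dots> \<le> (q ^ k - 1) * (q ^ k - 1) ^ r" by (intro mult_le_mono2 Suc)
  finally show ?case by simp
qed

text \<open>It is enough that the window contains the single word \<^term>\<open>Z\<close> obtained by concatenating all
  words of length at most \<^term>\<open>K\<close>; the probability to miss \<^term>\<open>Z\<close> decays geometrically in
  the number of blocks.\<close>

lemma window_contains_all_short_words:
  assumes "q > 0" "\<epsilon> > 0"
  obtains w where "\<And>i n. i + w \<le> n \<Longrightarrow>
    word_prob q n {W. \<exists>f. set f \<subseteq> {1..q} \<and> length f \<le> K \<and> \<not> sublist f (take w (drop i W))} \<le> \<epsilon>"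
proof -
  have "finite {f. set f \<subseteq> {1..q} \<and> length f \<le> K}" by (rule finite_lists_length_le) simp
  then obtain fs where fs: "set fs = {f. set f \<subseteq> {1..q} \<and> length f \<le> K}" by (metis finite_list)
  define Z where "Z = concat fs"
  define k where "k = length Z"
  have Z: "Z \<in> words q k" using fs by (auto simp: Z_def k_def words_def)
  have sub: "sublist f Z" if "set f \<subseteq> {1..q}" "length f \<le> K" for f
  proof -
    from that fs have "f \<in> set fs" by simp
    then obtain xs ys where "fs = xs @ f # ys" by (meson split_list)
    then show ?thesis by (auto simp: Z_def sublist_def)
  qed
  define \<rho> where "\<rho> = real (q ^ k - 1) / real q ^ k"
  have "real (q ^ k - 1) < real q ^ k" using assms(1)
    by (metis One_nat_def diff_less lessI of_nat_less_iff of_nat_power zero_less_power)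
  then have "0 \<le> \<rho>" "\<rho> < 1" using assms(1) by (auto simp: \<rho>_def)
  then obtain r where r: "\<rho> ^ r < \<epsilon>" using real_arch_pow_inv[OF assms(2)] by blast
  let ?w = "k * r"
  have "word_prob q n {W. \<exists>f. set f \<subseteq> {1..q} \<and> length f \<le> K \<and> \<not> sublist f (take ?w (drop i W))} \<le> \<epsilon>"
    if n: "i + ?w \<le> n" for i n
  proof -
    define A where "A = (\<lambda>(u, w). (u @ w, [] :: nat list)) `
      (words q i \<times> {w \<in> words q ?w. \<not> sublist Z w})"
    have A: "A \<subseteq> words q (i + ?w) \<times> words q 0" by (auto simp: A_def words_def subset_eq)
    have "card A \<le> q ^ i * card {w \<in> words q ?w. \<not> sublist Z w}"
      unfolding A_def by (rule order.trans[OF card_image_le])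
        (auto simp: finite_words card_cartesian_product card_words)
    also have "\<dots> \<le> q ^ i * (q ^ k - 1) ^ r"
      by (intro mult_le_mono2 card_avoiding_blocks assms Z)
    finally have "real (card A) \<le> real q ^ i * real (q ^ k - 1) ^ r"
      by (metis of_nat_le_iff of_nat_mult of_nat_power)
    then have cA: "real (card A) / real q ^ (i + ?w + 0) \<le> \<rho> ^ r"
      using assms(1) by (simp add: \<rho>_def power_add power_mult power_divide field_simps)
    have n': "i + ?w + (n - (i + ?w)) + 0 = n" using n by simp
    have "word_prob q n {W. \<exists>f. set f \<subseteq> {1..q} \<and> length f \<le> K \<and> \<not> sublist f (take ?w (drop i W))}
        \<le> word_prob q n {u @ m @ v |u m v. (u, v) \<in> A \<and> length m = n - (i + ?w)}"
    proof (rule word_prob_mono[OF assms(1)])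
      fix W assume W: "W \<in> words q n"
        and "W \<in> {W. \<exists>f. set f \<subseteq> {1..q} \<and> length f \<le> K \<and> \<not> sublist f (take ?w (drop i W))}"
      then have "\<not> sublist Z (take ?w (drop i W))"
        using sub sublist_order.order_trans by blast
      then have "(take i W @ take ?w (drop i W), []) \<in> A"
        using W n by (auto simp: A_def words_def dest!: in_set_takeD in_set_dropD intro!: image_eqI[of _ _ "(take i W, take ?w (drop i W))"])
      moreover have "W = (take i W @ take ?w (drop i W)) @ drop ?w (drop i W) @ []"
        by (metis append.assoc append_Nil2 append_take_drop_id)
      moreover have "length (drop ?w (drop i W)) = n - (i + ?w)" using W by (simp add: words_def)
      ultimately show "W \<in> {u @ m @ v |u m v. (u, v) \<in> A \<and> length m = n - (i + ?w)}" by blast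
    qed
    also have "\<dots> \<le> \<rho> ^ r"
      using word_prob_sandwich[OF assms(1) A, of "n - (i + ?w)"] cA unfolding n' by simp
    finally show ?thesis using r by simp
  qed
  then show thesis by (rule that)
qed

section \<open>Pairs in which every letter recurs\<close>

lemma bounded_sums_small_tail:
  fixes f :: "'b \<Rightarrow> real"
  assumes "\<And>F. finite F \<Longrightarrow> F \<subseteq> H \<Longrightarrow> sum f F \<le> C" and "\<epsilon> > 0"
  obtains F where "finite F" "F \<subseteq> H"
    "\<And>F'. finite F' \<Longrightarrow> F' \<subseteq> H \<Longrightarrow> F \<inter> F' = {} \<Longrightarrow> sum f F' \<le> \<epsilon>"
proof -
  let ?X = "sum f ` {F. finite F \<and> F \<subseteq> H}"
  have bdd: "bdd_above ?X" using assms(1) by (auto intro!: bdd_aboveI)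
  have "Sup ?X - \<epsilon> < Sup ?X" using assms(2) by simp
  then obtain F where F: "finite F" "F \<subseteq> H" "Sup ?X - \<epsilon> < sum f F"
    using less_cSup_iff[OF _ bdd, of "Sup ?X - \<epsilon>"] by blast
  have "sum f F' \<le> \<epsilon>" if "finite F'" "F' \<subseteq> H" "F \<inter> F' = {}" for F'
  proof -
    have "sum f (F \<union> F') \<le> Sup ?X" using that F by (intro cSup_upper bdd) auto
    then show ?thesis using F that by (simp add: sum.union_disjoint)
  qed
  with F that show thesis by blast
qed

text \<open>There are \<open>q\<close> to the power \<open>l\<close> words of length \<open>l\<close>, each of weight \<open>q\<close> to the power
  \<open>-2l\<close>; this leaves a geometric series with ratio \<^term>\<open>1 / real q\<close>, at most \<open>1 / 2\<close>.\<close>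

lemma sum_word_weights_le:
  assumes "q \<ge> 2" "finite B" "B \<subseteq> {w. set w \<subseteq> {1..q}}"
  shows "(\<Sum>w\<in>B. (1 / real q) ^ (2 * length w)) \<le> 2"
proof -
  obtain L where L: "\<And>w. w \<in> B \<Longrightarrow> length w \<le> L"
    using assms(2) by (metis finite_imageI finite_nat_set_iff_bounded_le image_eqI)
  have "(\<Sum>w\<in>B. (1 / real q) ^ (2 * length w)) \<le> (\<Sum>w\<in>(\<Union>l\<le>L. words q l). (1 / real q) ^ (2 * length w))"
    by (intro sum_mono2) (use assms L finite_words in \<open>auto simp: words_def\<close>)
  also have "\<dots> = (\<Sum>l\<le>L. \<Sum>w\<in>words q l. (1 / real q) ^ (2 * length w))"
    by (intro sum.UNION_disjoint) (auto simp: finite_words, auto simp: words_def)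
  also have "\<dots> = (\<Sum>l\<le>L. \<Sum>w\<in>words q l. (1 / real q) ^ (2 * l))"
    by (intro sum.cong refl) (auto simp: words_def)
  also have "\<dots> = (\<Sum>l\<le>L. (1 / real q) ^ l)"
    using assms(1) by (simp add: card_words mult_2 power_add power_divide)
  also have "\<dots> \<le> (\<Sum>l\<le>L. (1 / 2) ^ l)"
    using assms(1) by (intro sum_mono power_mono) (auto simp: field_simps)
  also have "\<dots> = 2 - (1 / 2) ^ L" by (induction L) auto
  finally show ?thesis by (smt (verit) zero_le_power divide_nonneg_nonneg)
qed

text \<open>Enlarging \<^term>\<open>F\<close> to the full product of its projections lets the sum factor over the
  letters in \<^term>\<open>Y\<close>.\<close>

lemma sum_substitution_weights_le:
  fixes Y :: "'a set"
  assumes "q \<ge> 2" "finite Y" "finite F" "F \<subseteq> Y \<rightarrow>\<^sub>E {w. w \<noteq> [] \<and> set w \<subseteq> {1..q}}"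
  shows "(\<Sum>h\<in>F. \<Prod>y\<in>Y. (1 / real q) ^ (2 * length (h y))) \<le> 2 ^ card Y"
proof -
  let ?B = "\<lambda>y. (\<lambda>h. h y) ` F"
  have "F \<subseteq> PiE Y ?B" using assms(4) by (auto simp: PiE_iff)
  then have "(\<Sum>h\<in>F. \<Prod>y\<in>Y. (1 / real q) ^ (2 * length (h y)))
      \<le> (\<Sum>h\<in>PiE Y ?B. \<Prod>y\<in>Y. (1 / real q) ^ (2 * length (h y)))"
    using assms(2,3) by (intro sum_mono2 finite_PiE prod_nonneg) auto
  also have "\<dots> = (\<Prod>y\<in>Y. \<Sum>w\<in>?B y. (1 / real q) ^ (2 * length w))"
    using assms(2,3) by (subst prod_sum_PiE) auto
  also have "\<dots> \<le> (\<Prod>y\<in>Y. 2)"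
    using assms by (intro prod_mono conjI sum_nonneg sum_word_weights_le) (auto simp: PiE_iff)
  finally show ?thesis by simp
qed

lemma length_image_of_doubled_ge:
  assumes "\<And>y. y \<in> set U \<Longrightarrow> count_list U y \<ge> 2"
  shows "(\<Sum>y\<in>set U. 2 * length (h y)) \<le> length (concat (map h U))"
proof -
  have "length (concat (map h U)) = (\<Sum>y\<in>set U. count_list U y * length (h y))"
    by (simp add: length_concat o_def sum_list_map_eq_sum_count)
  then show ?thesis using assms by (auto intro!: sum_mono)
qed

lemma word_prob_prefix_suffix_le:
  assumes "q > 0" "set p \<subseteq> {1..q}" "set s \<subseteq> {1..q}"
  shows "word_prob q n {p @ m @ s |m. True} \<le> (1 / real q) ^ (length p + length s)"
proof (cases "length p + length s \<le> n")
  case True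
  let ?k = "n - length p - length s"
  have n: "length p + ?k + length s = n" using True by simp
  have "word_prob q n {p @ m @ s |m. True}
      \<le> word_prob q n {u @ m @ v |u m v. (u, v) \<in> {(p, s)} \<and> length m = ?k}"
    by (rule word_prob_mono[OF assms(1)]) (auto simp: words_def)
  also have "\<dots> = (1 / real q) ^ (length p + length s)"
    using word_prob_sandwich[of q "{(p, s)}" "length p" "length s" ?k] assms
    unfolding n by (simp add: words_def power_divide)
  finally show ?thesis .
next
  case False
  then have "words q n \<inter> {p @ m @ s |m. True} = {}" by (auto simp: words_def)
  then show ?thesis using assms(1) by (simp add: word_prob_eq_card)
qed

text \<open>The union bound. A fixed substitution \<^term>\<open>h\<close> prescribes as many letters of \<^term>\<open>W\<close> as the
  image of \<^term>\<open>P @ S\<close> has, which is at least twice the sum of the lengths \<^term>\<open>length (h y)\<close>,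
  so the probability of a match by \<^term>\<open>h\<close> is at most its weight. The weights have bounded sums, hence
  all substitutions outside a finite set \<open>F\<close> contribute at most \<^term>\<open>\<epsilon>\<close>, and \<^term>\<open>M\<close> is
  chosen so that the images under members of \<open>F\<close> are not longer than \<^term>\<open>M\<close>.\<close>

lemma tight_of_doubled:
  assumes "q \<ge> 2" and "\<And>y. y \<in> set (P @ S) \<Longrightarrow> count_list (P @ S) y \<ge> 2"
  shows "tight_pair q P S"
  unfolding tight_pair_def
proof (intro allI impI)
  fix \<epsilon> :: real assume "\<epsilon> > 0"
  let ?Y = "set (P @ S)"
  define H where "H = (?Y \<rightarrow>\<^sub>E {w. w \<noteq> [] \<and> set w \<subseteq> {1..q}})"
  define wt where "wt = (\<lambda>h. \<Prod>y\<in>?Y. (1 / real q) ^ (2 * length (h y :: nat list)))"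
  have "sum wt F \<le> 2 ^ card ?Y" if "finite F" "F \<subseteq> H" for F
    unfolding wt_def
    by (rule sum_substitution_weights_le) (use assms(1) that in \<open>simp_all add: H_def\<close>)
  then obtain F where F: "finite F" "F \<subseteq> H"
    "\<And>F'. finite F' \<Longrightarrow> F' \<subseteq> H \<Longrightarrow> F \<inter> F' = {} \<Longrightarrow> sum wt F' \<le> \<epsilon>"
    by (rule bounded_sums_small_tail[of H wt, OF _ \<open>\<epsilon> > 0\<close>]) (use that in auto)
  obtain M where M: "\<And>h. h \<in> F \<Longrightarrow> length (concat (map h (P @ S))) \<le> M"
  proof (rule that)
    show "length (concat (map h (P @ S))) \<le> Max ((\<lambda>h. length (concat (map h (P @ S)))) ` F)"
      if "h \<in> F" for h
      using F(1) that by (intro Max_ge) auto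
  qed
  have q: "q > 0" using assms(1) by simp
  have "word_prob q n {W. matches P S n W \<and> \<not> matches P S M W} \<le> \<epsilon>" for n
  proof -
    define F' where "F' = {h \<in> H. h \<notin> F \<and> (\<forall>y\<in>?Y. length (h y) \<le> n)}"
    have "F' \<subseteq> (?Y \<rightarrow>\<^sub>E {w. set w \<subseteq> {1..q} \<and> length w \<le> n})"
      by (auto simp: F'_def H_def PiE_iff extensional_def)
    then have fin: "finite F'"
      by (rule finite_subset) (intro finite_PiE finite_lists_length_le, auto)
    let ?E = "\<lambda>h. {concat (map h P) @ m @ concat (map h S) |m. True}"
    have "word_prob q n {W. matches P S n W \<and> \<not> matches P S M W} \<le> word_prob q n (\<Union>h\<in>F'. ?E h)"
    proof (rule word_prob_mono[OF q])
      fix W assume W: "W \<in> words q n" "W \<in> {W. matches P S n W \<and> \<not> matches P S M W}"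
      then obtain h m where h: "\<forall>x. h x \<noteq> []" "m \<noteq> []" "W = concat (map h P) @ m @ concat (map h S)"
        by (auto simp: matches_def)
      \<comment> \<open>Only the values on \<open>?Y\<close> matter; restricting makes the substitution a member of \<^term>\<open>H\<close>,
        so that each set of values is counted once.\<close>
      define g where "g = restrict h ?Y"
      have g: "map g P = map h P" "map g S = map h S" by (auto simp: g_def)
      have sub: "set (h y) \<subseteq> {1..q} \<and> length (h y) \<le> n" if "y \<in> ?Y" for y
      proof -
        have "sublist (h y) W"
        proof -
          from that consider "y \<in> set P" | "y \<in> set S" by auto
          then show ?thesis
          proof cases
            case 1 then obtain a b where "P = a @ y # b" by (meson split_list)
            then show ?thesis unfolding h(3) sublist_def
              by (intro exI[of _ "concat (map h a)"] exI[of _ "concat (map h b) @ m @ concat (map h S)"]) simp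
          next
            case 2 then obtain a b where "S = a @ y # b" by (meson split_list)
            then show ?thesis unfolding h(3) sublist_def
              by (intro exI[of _ "concat (map h P) @ m @ concat (map h a)"] exI[of _ "concat (map h b)"]) simp
          qed
        qed
        then show ?thesis using W(1) set_mono_sublist[of "h y" W] sublist_length_le[of "h y" W]
          by (auto simp: words_def)
      qed
      have "g \<in> H" using sub h(1) by (auto simp: g_def H_def)
      moreover have "g \<notin> F"
      proof
        assume "g \<in> F"
        from M[OF this] have "matches P S M W" unfolding matches_def
          using h g by (intro exI[of _ h] exI[of _ m]) simp
        then show False using W by simp
      qed
      ultimately have "g \<in> F'" using sub by (auto simp: F'_def g_def)
      moreover have "W \<in> ?E g" using h(3) unfolding g by blast
      ultimately show "W \<in> (\<Union>h\<in>F'. ?E h)" by blast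
    qed
    also have "\<dots> \<le> (\<Sum>h\<in>F'. word_prob q n (?E h))"
      by (intro measure_pmf.finite_measure_subadditive_finite fin) auto
    also have "\<dots> \<le> sum wt F'"
    proof (rule sum_mono)
      fix h assume "h \<in> F'"
      then have "\<And>y. y \<in> ?Y \<Longrightarrow> set (h y) \<subseteq> {1..q}" by (auto simp: F'_def H_def PiE_iff)
      then have "word_prob q n (?E h) \<le> (1 / real q) ^ length (concat (map h (P @ S)))"
        using word_prob_prefix_suffix_le[OF q, of "concat (map h P)" "concat (map h S)" n] by fastforce
      also have "\<dots> \<le> (1 / real q) ^ (\<Sum>y\<in>?Y. 2 * length (h y))"
        using q by (intro power_decreasing length_image_of_doubled_ge assms(2)) auto
      also have "\<dots> = wt h" by (simp add: wt_def power_sum)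
      finally show "word_prob q n (?E h) \<le> wt h" .
    qed
    also have "\<dots> \<le> \<epsilon>" by (rule F(3)) (use fin in \<open>auto simp: F'_def\<close>)
    finally show ?thesis .
  qed
  then show "\<exists>M. \<forall>n. word_prob q n {W. matches P S n W \<and> \<not> matches P S M W} \<le> \<epsilon>" by blast
qed

section \<open>Splitting off a letter that occurs once\<close>

lemma matches_drop_free_part:
  "matches (P @ z # Q) S N W \<Longrightarrow> matches P S N W"
proof -
  assume "matches (P @ z # Q) S N W"
  then obtain h m where h: "\<forall>x. h x \<noteq> []" "W = concat (map h (P @ z # Q)) @ m @ concat (map h S)"
    "length (concat (map h (P @ z # Q))) + length (concat (map h S)) \<le> N" unfolding matches_def by blast
  then show ?thesis unfolding matches_def
    by (intro exI[of _ h] exI[of _ "h z @ concat (map h Q) @ m"]) simp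
qed

text \<open>The image of \<^term>\<open>P\<close> ends within the first \<^term>\<open>M\<close> letters, so an occurrence of the image of
  \<^term>\<open>Q\<close> in the window starting after \<^term>\<open>M + 1\<close> letters leaves at least one letter for the
  image of \<^term>\<open>z\<close>. The length condition keeps the window clear of the image of \<^term>\<open>S\<close>.\<close>

lemma matches_insert_floating:
  assumes z: "z \<notin> set P" "z \<notin> set Q" "z \<notin> set S"
    and W: "set W \<subseteq> {1..q}" "q > 0" "length W > 2 * M + w + 2"
    and m: "matches P S M W"
    and all: "\<And>f. set f \<subseteq> {1..q} \<Longrightarrow> length f \<le> length Q * (M + 1) \<Longrightarrow>
                 sublist f (take w (drop (M + 1) W))"
  shows "matches (P @ z # Q) S (2 * M + w + 2) W"
proof -
  obtain h m where h: "\<forall>x. h x \<noteq> []" "m \<noteq> []" "W = concat (map h P) @ m @ concat (map h S)"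
    "length (concat (map h P)) + length (concat (map h S)) \<le> M"
    using m unfolding matches_def by blast
  \<comment> \<open>Letters of \<^term>\<open>Q\<close> that occur in neither \<^term>\<open>P\<close> nor \<^term>\<open>S\<close> are not constrained by the
    given match; sending them to a single letter keeps the image of \<^term>\<open>Q\<close> short.\<close>
  define g where "g = (\<lambda>x. if x \<in> set P \<union> set S then h x else [1])"
  have sub: "set (g x) \<subseteq> {1..q} \<and> length (g x) \<le> M + 1" for x
  proof (cases "x \<in> set P \<union> set S")
    case True
    then have "length (h x) \<le> length (concat (map h P)) + length (concat (map h S))"
      by (auto simp: length_concat member_le_sum_list trans_le_add1 trans_le_add2)
    moreover have "set (h x) \<subseteq> set W" using True by (auto simp: h(3))
    ultimately show ?thesis using True h(4) W by (auto simp: g_def)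
  qed (use W in \<open>auto simp: g_def\<close>)
  let ?f = "concat (map g Q)"
  have "length ?f \<le> length Q * (M + 1)"
  proof (induction Q)
    case (Cons x Q)
    then show ?case using sub[of x] by simp
  qed simp
  moreover have "set ?f \<subseteq> {1..q}" using sub by auto
  ultimately obtain a b where ab: "take w (drop (M + 1) W) = a @ ?f @ b"
    using all unfolding sublist_def by metis
  let ?p = "concat (map h P)" and ?s = "concat (map h S)"
  define d where "d = M + 1 - length ?p"
  have lm: "length m > d + w"
    using arg_cong[OF h(3), of length] W(3) h(4) by (simp add: d_def)
  have "drop (M + 1) W = drop d m @ ?s"
    using h(4) lm by (simp add: h(3) d_def)
  then have "take w (drop d m) = a @ ?f @ b" using ab lm by simp
  then have m_eq: "m = (take d m @ a) @ ?f @ (b @ drop w (drop d m))"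
    by (metis append.assoc append_take_drop_id)
  have len_f: "length a + length ?f \<le> w"
    using arg_cong[OF ab, of length] by simp
  have d: "d > 0" using h(4) by (simp add: d_def)
  define g' where "g' = g(z := take d m @ a)"
  have g': "map g' P = map h P" "map g' S = map h S" "map g' Q = map g Q" "g' z = take d m @ a"
    using z by (auto simp: g'_def g_def)
  show ?thesis unfolding matches_def
  proof (intro exI conjI)
    show "\<forall>x. g' x \<noteq> []" using h(1,2) d by (auto simp: g'_def g_def)
    show "b @ drop w (drop d m) \<noteq> []" using lm by simp
    show "W = concat (map g' (P @ z # Q)) @ (b @ drop w (drop d m)) @ concat (map g' S)"
      using h(3) m_eq by (simp add: g')
    show "length (concat (map g' (P @ z # Q))) + length (concat (map g' S)) \<le> 2 * M + w + 2"
      using h(4) len_f lm by (simp add: g' d_def)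
  qed
qed

text \<open>A match of \<^term>\<open>(P @ z # Q, S)\<close> is in particular a match of \<^term>\<open>(P, S)\<close>. If the word is
  long and has no short match of \<^term>\<open>(P @ z # Q, S)\<close>, then either \<^term>\<open>(P, S)\<close> has no short match or the window misses
  some short word; both have small probability.\<close>

lemma tight_insert_floating:
  assumes "q > 0" and z: "z \<notin> set P" "z \<notin> set Q" "z \<notin> set S" and "tight_pair q P S"
  shows "tight_pair q (P @ z # Q) S"
  unfolding tight_pair_def
proof (intro allI impI)
  fix \<epsilon> :: real assume "\<epsilon> > 0"
  then have "\<epsilon> / 2 > 0" by simp
  then obtain M where M: "\<And>n. word_prob q n {W. matches P S n W \<and> \<not> matches P S M W} \<le> \<epsilon> / 2"
    using assms(5) unfolding tight_pair_def by meson
  obtain w where w: "\<And>i n. i + w \<le> n \<Longrightarrow>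
    word_prob q n {W. \<exists>f. set f \<subseteq> {1..q} \<and> length f \<le> length Q * (M + 1) \<and>
                   \<not> sublist f (take w (drop i W))} \<le> \<epsilon> / 2"
    using window_contains_all_short_words[OF assms(1) \<open>\<epsilon> / 2 > 0\<close>, of "length Q * (M + 1)"]
    by blast
  \<comment> \<open>Room for the first \<^term>\<open>M + 1\<close> letters, the window, the last \<^term>\<open>M\<close> letters, and a gap.\<close>
  let ?N = "2 * M + w + 2"
  have "word_prob q n {W. matches (P @ z # Q) S n W \<and> \<not> matches (P @ z # Q) S ?N W} \<le> \<epsilon>" for n
  proof (cases "n \<le> ?N")
    case True
    then have none: "{W. matches (P @ z # Q) S n W \<and> \<not> matches (P @ z # Q) S ?N W} = {}"
      using matches_mono by blast
    show ?thesis unfolding none using \<open>\<epsilon> > 0\<close> by simp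
  next
    case False
    let ?A = "{W. matches P S n W \<and> \<not> matches P S M W}"
    let ?B = "{W. \<exists>f. set f \<subseteq> {1..q} \<and> length f \<le> length Q * (M + 1) \<and>
                   \<not> sublist f (take w (drop (M + 1) W))}"
    have "word_prob q n {W. matches (P @ z # Q) S n W \<and> \<not> matches (P @ z # Q) S ?N W} \<le> word_prob q n (?A \<union> ?B)"
    proof (rule word_prob_mono[OF assms(1)])
      fix W assume W: "W \<in> words q n"
        "W \<in> {W. matches (P @ z # Q) S n W \<and> \<not> matches (P @ z # Q) S ?N W}"
      then have "matches P S n W" using matches_drop_free_part[of P z Q S n W] by blast
      moreover have "\<not> (matches P S M W \<and> W \<notin> ?B)"
        using matches_insert_floating[OF z, of W q M w] W False assms(1) by (auto simp: words_def)
      ultimately show "W \<in> ?A \<union> ?B" by blast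
    qed
    also have "\<dots> \<le> word_prob q n ?A + word_prob q n ?B"
      by (rule measure_Un_le) auto
    also have "\<dots> \<le> \<epsilon>" using M[of n] w[of "M + 1" n] False by simp
    finally show ?thesis .
  qed
  then show "\<exists>N. \<forall>n. word_prob q n {W. matches (P @ z # Q) S n W \<and> \<not> matches (P @ z # Q) S N W} \<le> \<epsilon>"
    by blast
qed

lemma tight_pair_all:
  assumes "q \<ge> 2"
  shows "tight_pair q P S"
proof (induction "length P + length S" arbitrary: P S rule: less_induct)
  case less
  have q: "q > 0" using assms by simp
  show ?case
  proof (cases "\<exists>z \<in> set (P @ S). count_list (P @ S) z = 1")
    case False
    have "count_list (P @ S) y \<ge> 2" if "y \<in> set (P @ S)" for y
      using False that by (metis One_nat_def Suc_1 Suc_leI count_list_0_iff le_neq_implies_less less_one not_less)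
    then show ?thesis by (rule tight_of_doubled[OF assms])
  next
    case True
    then obtain z where z: "z \<in> set P \<or> z \<in> set S" "count_list P z + count_list S z = 1" by auto
    show ?thesis
    proof (cases "z \<in> set P")
      case True
      then obtain P' Q where P: "P = P' @ z # Q" by (meson split_list)
      then have "z \<notin> set P'" "z \<notin> set Q" "z \<notin> set S"
        using z(2) by (auto simp: P count_list_0_iff)
      moreover have "tight_pair q P' S" by (rule less) (simp add: P)
      ultimately show ?thesis unfolding P by (intro tight_insert_floating[OF q])
    next
      case False
      then obtain Q S' where S: "S = Q @ z # S'" using z(1) by (meson split_list)
      then have "z \<notin> set S'" "z \<notin> set Q" "z \<notin> set P"
        using z(2) by (auto simp: S count_list_0_iff)
      moreover have "tight_pair q (rev S') (rev P)" by (rule less) (simp add: S)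
      ultimately have "tight_pair q (rev S' @ z # rev Q) (rev P)" by (intro tight_insert_floating[OF q]) auto
      then show ?thesis using tight_rev[OF q, of S P] by (simp add: S)
    qed
  qed
qed

section \<open>The probability of being an instance\<close>

lemma nondoubledE:
  assumes "nondoubled V"
  obtains P x S where "V = P @ x # S" "x \<notin> set P" "x \<notin> set S"
proof -
  from assms obtain x where x: "x \<in> set V" "count_list V x = 1" by (auto simp: nondoubled_def)
  then obtain P S where V: "V = P @ x # S" by (meson split_list)
  then show thesis using that x(2) by (auto simp: V count_list_0_iff)
qed

text \<open>Assign to each letter of \<^term>\<open>V\<close> a single letter, independently, and append
  \<^term>\<open>n - length V\<close> arbitrary letters to the image of \<^term>\<open>x\<close>. Different choices give different
  words, since the original assignment can be read off at fixed positions.\<close>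

lemma instance_prob_ge:
  assumes q: "q > 0" and "nondoubled V" "n \<ge> length V"
  shows "instance_prob n V q \<ge> real q powi (- int (recurrences V))"
proof -
  obtain P x S where V: "V = P @ x # S" and x: "x \<notin> set P" "x \<notin> set S"
    by (rule nondoubledE[OF assms(2)])
  let ?G = "\<lambda>g. (map g P @ [g x], map g S)"
  define A where "A = ?G ` (set V \<rightarrow>\<^sub>E {1..q})"
  have inj: "inj_on ?G (set V \<rightarrow>\<^sub>E {1..q})"
  proof (rule inj_onI)
    fix g g'
    assume g: "g \<in> set V \<rightarrow>\<^sub>E {1..q}" and g': "g' \<in> set V \<rightarrow>\<^sub>E {1..q}" and eq: "?G g = ?G g'"
    show "g = g'"
      by (rule PiE_ext[OF g g']) (use eq in \<open>auto simp: V\<close>)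
  qed
  have cA: "card A = q ^ card (set V)"
    unfolding A_def card_image[OF inj] by (simp add: card_PiE)
  have A: "A \<subseteq> words q (length P + 1) \<times> words q (length S)"
    by (auto simp: A_def words_def V PiE_iff)
  let ?k = "n - length V"
  have n: "length P + 1 + ?k + length S = n" using assms(3) by (simp add: V)
  have le: "card (set V) \<le> length V" by (rule card_length)
  have "real q powi (- int (recurrences V)) = real q ^ card (set V) / real q ^ length V"
  proof -
    have "real q ^ length V = real q ^ recurrences V * real q ^ card (set V)"
      using le by (simp add: recurrences_def power_add[symmetric])
    then show ?thesis using q by (simp add: power_int_minus field_simps)
  qed
  also have "\<dots> = word_prob q n {u @ m @ v |u m v. (u, v) \<in> A \<and> length m = ?k}"
    using word_prob_sandwich[OF q A, of ?k] unfolding n cA by (simp add: V)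
  also have "\<dots> \<le> instance_prob n V q"
    unfolding instance_prob_def
  proof (rule word_prob_mono[OF q])
    fix W assume "W \<in> {u @ m @ v |u m v. (u, v) \<in> A \<and> length m = ?k}"
    then obtain u m v where "W = u @ m @ v" "(u, v) \<in> A" by blast
    moreover from this obtain g where "u = map g P @ [g x]" "v = map g S" unfolding A_def by blast
    ultimately have W: "W = map g P @ (g x # m) @ map g S" by simp
    define h where "h = (\<lambda>y. if y = x then g x # m else [g y])"
    have "concat (map h P) = map g P" using x by (induction P) (auto simp: h_def)
    moreover have "concat (map h S) = map g S" using x by (induction S) (auto simp: h_def)
    ultimately have "W = concat (map h V)" by (simp add: V W h_def)
    moreover have "\<forall>y. h y \<noteq> []" by (simp add: h_def)
    ultimately show "W \<in> {U. instance_of V U}" by (auto simp: instance_of_iff)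
  qed
  finally show ?thesis .
qed

lemma instance_prob_convergent:
  assumes q: "q > 0" and "nondoubled V"
  shows "convergent (\<lambda>n. instance_prob n V q)"
proof (cases "q = 1")
  case True
  have "\<forall>\<^sub>F n in sequentially. instance_prob n V q = 1"
  proof (rule eventually_sequentiallyI)
    fix n assume "length V \<le> n"
    from instance_prob_ge[OF q assms(2) this] have "instance_prob n V q \<ge> 1" by (simp add: True)
    then show "instance_prob n V q = 1"
      by (simp add: instance_prob_def order_antisym)
  qed
  then show ?thesis by (metis convergent_def tendsto_eventually)
next
  case False
  obtain P x S where V: "V = P @ x # S" and x: "x \<notin> set P" "x \<notin> set S"
    by (rule nondoubledE[OF assms(2)])
  have "instance_prob n V q = word_prob q n {W. matches P S n W}" for n
    unfolding instance_prob_def V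
    by (intro antisym; rule word_prob_mono[OF q]) (auto simp: instance_of_iff_matches[OF x] words_def)
  moreover have "q \<ge> 2" using q False by simp
  ultimately show ?thesis using tight_imp_convergent[OF q tight_pair_all] by simp
qed

theorem theorem4p11:
  fixes V :: "'a list" and q :: nat
  assumes "nondoubled V" and "q > 0"
  shows "convergent (\<lambda>n. instance_prob n V q) \<and>
         asymptotic_instance_prob V q \<ge> real q powi (- int (recurrences V)) \<and>
         real q powi (- int (recurrences V)) > 0"
proof (intro conjI)
  show conv: "convergent (\<lambda>n. instance_prob n V q)"
    using instance_prob_convergent assms by blast
  then have "(\<lambda>n. instance_prob n V q) \<longlonglongrightarrow> asymptotic_instance_prob V q"
    unfolding asymptotic_instance_prob_def by (rule convergent_LIMSEQ_iff[THEN iffD1])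
  then show "asymptotic_instance_prob V q \<ge> real q powi (- int (recurrences V))"
    by (rule LIMSEQ_le_const) (use instance_prob_ge[OF assms(2,1)] in blast)
  show "real q powi (- int (recurrences V)) > 0" using assms(2) by simp
qed

end
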